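(* Any positive algorithm (on partially ordered sets) is $ci$-regular, and the complexity of its interval version is the same as the complexity of the algorithm itself.
   Context: An algorithm $\mathcal{A}$ on partially ordered sets (posets) takes input data in a finite Cartesian product $S=S_1\times\cdots\times S_n$ of posets and generates output in a finite Cartesian product $T=T_1\times\cdots\times T_m$ of posets, and so induces a mapping $f_{\mathcal{A}}\colon S\to T$. Cartesian products carry the componentwise order. The algorithm is positive (nondecreasing) if $x\preceq y$ implies $f_{\mathcal{A}}(x)\preceq f_{\mathcal{A}}(y)$. A closed interval in a poset $S$ is a subset $\mathbf{x}=[\underline{\mathbf{x}},\overline{\mathbf{x}}]=\{t\in S:\underline{\mathbf{x}}\preceq t\preceq\overline{\mathbf{x}}\}$ with $\underline{\mathbf{x}}\preceq\overline{\mathbf{x}}$ in $S$; $I(S)$ denotes the set of closed intervals in $S$, viewed as pairs of lower and upper bounds. A mapping $f\colon S\to T$ of posets is interval regular ($i$-regular) if for every interval $\mathbf{x}\subseteq S$ there is an interval $\mathbf{y}=[\underline{\mathbf{y}},\overline{\mathbf{y}}]\subseteq T$ with $f(\mathbf{x})\subseteq\mathbf{y}$, $\underline{\mathbf{y}}\in f(\mathbf{x})$ and $\overline{\mathbf{y}}\in f(\mathbf{x})$. The interval extension (interval version) $I(\mathcal{A})$ of a positive algorithm $\mathcal{A}$ is defined on the bounds of intervals: it runs $\mathcal{A}$ on the lower bound and on the upper bound, i.e. it induces the mapping $I(S_1)\times\cdots\times I(S_n)\to I(T_1)\times\cdots\times I(T_m)$, $[\underline{\mathbf{x}},\overline{\mathbf{x}}]\mapsto[f_{\mathcal{A}}(\underline{\mathbf{x}}),f_{\mathcal{A}}(\overline{\mathbf{x}})]$.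 Two algorithms have the same complexity if they have the same asymptotic time and space complexity (as functions of the input size, in the big-$O$ sense, so multiplicative constants are ignored; time is estimated by the number of elementary operations performed). An algorithm $\mathcal{A}$ is $ci$-regular if $f_{\mathcal{A}}$ is interval regular and $\mathcal{A}$ and its interval extension have the same (asymptotic) complexity. *)

theory Defs
  imports Main "HOL-Library.Extended_Nat"
begin

section \<open>Posets, products and intervals\<close>

text \<open>
  A poset is a relation \<open>r\<close> with \<open>Partial_order r\<close>; its carrier is \<open>Field r\<close>. A finite product
  \<open>S\<^sub>1 \<times> \<dots> \<times> S\<^sub>n\<close> is given by the list of its factors, and its elements are lists of length \<open>n\<close>.
  The factors share an element type, which is no restriction because finitely many
  types embed in their sum.
\<close>

definition product :: "'a rel list \<Rightarrow> 'a list set" where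
  "product Ss = listset (map Field Ss)"

definition product_order :: "'a rel list \<Rightarrow> 'a list rel" where
  "product_order Ss = {(xs, ys). xs \<in> product Ss \<and> ys \<in> product Ss \<and>
     (\<forall>i<length Ss. (xs ! i, ys ! i) \<in> Ss ! i)}"

definition intervals :: "'a rel \<Rightarrow> ('a \<times> 'a) set" where
  "intervals r = {(l, u). l \<in> Field r \<and> u \<in> Field r \<and> (l, u) \<in> r}"

definition interval_set :: "'a rel \<Rightarrow> 'a \<times> 'a \<Rightarrow> 'a set" where
  "interval_set r x = {t \<in> Field r. (fst x, t) \<in> r \<and> (t, snd x) \<in> r}"

text \<open>\<open>I(S\<^sub>1) \<times> \<dots> \<times> I(S\<^sub>n)\<close>\<close>

definition interval_product :: "'a rel list \<Rightarrow> ('a \<times> 'a) list set" where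
  "interval_product Ss = listset (map intervals Ss)"

definition interval_regular :: "'a rel \<Rightarrow> 'b rel \<Rightarrow> ('a \<Rightarrow> 'b) \<Rightarrow> bool" where
  "interval_regular r s f \<longleftrightarrow>
     (\<forall>x\<in>intervals r. \<exists>y\<in>intervals s.
        f ` interval_set r x \<subseteq> interval_set s y \<and>
        fst y \<in> f ` interval_set r x \<and> snd y \<in> f ` interval_set r x)"


section \<open>Algorithms\<close>

text \<open>
  An algorithm is a program acting on a memory whose cells (addressed by \<open>'c\<close>) are empty or hold
  a value. One elementary operation either overwrites or erases a single cell, whose address may
  be computed, or evaluates a test. Which functions may occur in a single operation is left
  open, as it depends on the problem domain. The program halts when it reaches a label (of
  type \<open>'l\<close>) that carries no instruction.
\<close>

type_synonym ('c, 'v) memory = "'c \<rightharpoonup> 'v"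

datatype ('l, 'c, 'v) instr =
    Write (address: "('c, 'v) memory \<Rightarrow> 'c") (content: "('c, 'v) memory \<Rightarrow> 'v option") (succ: 'l)
  | Branch (test: "('c, 'v) memory \<Rightarrow> bool") (succ_true: 'l) (succ_false: 'l)

text \<open>
  \<open>load\<close> says how input data are laid out in the initial memory (one datum may occupy several cells),
  and \<open>result\<close> how output data are read off the final memory.
\<close>

record ('l, 'c, 'v, 'a, 'b) algorithm =
  entry :: 'l
  program :: "'l \<rightharpoonup> ('l, 'c, 'v) instr"
  load :: "'a list \<Rightarrow> ('c, 'v) memory"
  result :: "('c, 'v) memory \<Rightarrow> 'b list"

fun exec :: "('l, 'c, 'v) instr \<Rightarrow> ('c, 'v) memory \<Rightarrow> 'l \<times> ('c, 'v) memory" where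
  "exec (Write a e l) M = (l, M(a M := e M))"
| "exec (Branch p l l') M = (if p M then l else l', M)"

definition step :: "('l, 'c, 'v, 'a, 'b) algorithm \<Rightarrow> 'l \<times> ('c, 'v) memory \<Rightarrow> 'l \<times> ('c, 'v) memory" where
  "step A c = (case program A (fst c) of None \<Rightarrow> c | Some i \<Rightarrow> exec i (snd c))"

definition config :: "('l, 'c, 'v, 'a, 'b) algorithm \<Rightarrow> 'a list \<Rightarrow> nat \<Rightarrow> 'l \<times> ('c, 'v) memory" where
  "config A x k = (step A ^^ k) (entry A, load A x)"

definition halted :: "('l, 'c, 'v, 'a, 'b) algorithm \<Rightarrow> 'a list \<Rightarrow> nat \<Rightarrow> bool" where
  "halted A x k \<longleftrightarrow> program A (fst (config A x k)) = None"

definition time :: "('l, 'c, 'v, 'a, 'b) algorithm \<Rightarrow> 'a list \<Rightarrow> nat" where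
  "time A x = (LEAST k. halted A x k)"

definition space :: "('l, 'c, 'v, 'a, 'b) algorithm \<Rightarrow> 'a list \<Rightarrow> nat" where
  "space A x = Max ((\<lambda>k. card (dom (snd (config A x k)))) ` {..time A x})"

definition induced_map :: "('l, 'c, 'v, 'a, 'b) algorithm \<Rightarrow> 'a list \<Rightarrow> 'b list" where
  "induced_map A x = result A (snd (config A x (time A x)))"

text \<open>
  \<open>A\<close> is an algorithm with input data in \<open>X\<close> and output in \<open>Y\<close>. As a step changes at most one cell,
  finiteness of the initial memory makes every later memory finite, so \<^const>\<open>space\<close> is meaningful.
\<close>

definition algorithm_on :: "'a list set \<Rightarrow> 'b list set \<Rightarrow> ('l, 'c, 'v, 'a, 'b) algorithm \<Rightarrow> bool" where
  "algorithm_on X Y A \<longleftrightarrow> finite (dom (program A)) \<and>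
     (\<forall>x\<in>X. finite (dom (load A x)) \<and> (\<exists>k. halted A x k) \<and> induced_map A x \<in> Y)"

definition positive :: "'a rel list \<Rightarrow> 'b rel list \<Rightarrow> ('l, 'c, 'v, 'a, 'b) algorithm \<Rightarrow> bool" where
  "positive Ss Ts A \<longleftrightarrow>
     monotone_on (product Ss) (\<lambda>x y. (x, y) \<in> product_order Ss) (\<lambda>x y. (x, y) \<in> product_order Ts)
       (induced_map A)"


section \<open>Asymptotic complexity\<close>

text \<open>
  Worst case of a cost measure over the inputs of size at most \<open>N\<close>. It may be infinite, as a
  poset may have infinitely many elements of a given size; hence the values in \<^typ>\<open>enat\<close>, to
  which the Landau symbols of the library do not apply.
\<close>

definition worst_case :: "'x set \<Rightarrow> ('x \<Rightarrow> nat) \<Rightarrow> ('x \<Rightarrow> nat) \<Rightarrow> nat \<Rightarrow> enat" where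
  "worst_case X sz cost N = (SUP x\<in>{x \<in> X. sz x \<le> N}. enat (cost x))"

definition bigo_enat :: "(nat \<Rightarrow> enat) \<Rightarrow> (nat \<Rightarrow> enat) \<Rightarrow> bool" where
  "bigo_enat f g \<longleftrightarrow> (\<exists>c::nat. \<forall>\<^sub>F N in sequentially. f N \<le> enat c * g N)"

definition same_order :: "(nat \<Rightarrow> enat) \<Rightarrow> (nat \<Rightarrow> enat) \<Rightarrow> bool" where
  "same_order f g \<longleftrightarrow> bigo_enat f g \<and> bigo_enat g f"

definition same_complexity ::
  "'a list set \<Rightarrow> ('a list \<Rightarrow> nat) \<Rightarrow> ('l, 'c, 'v, 'a, 'b) algorithm \<Rightarrow>
   'a2 list set \<Rightarrow> ('a2 list \<Rightarrow> nat) \<Rightarrow> ('l2, 'c2, 'v2, 'a2, 'b2) algorithm \<Rightarrow> bool" where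
  "same_complexity X sz A X' sz' B \<longleftrightarrow>
     same_order (worst_case X sz (time A)) (worst_case X' sz' (time B)) \<and>
     same_order (worst_case X sz (space A)) (worst_case X' sz' (space B))"


section \<open>Interval extension\<close>

text \<open>
  The memory of the interval extension consists of two banks, holding the data for the lower
  and for the upper bounds. Its program is a copy of the program of \<open>A\<close> acting on the lower bank
  followed by a copy acting on the upper bank: where the first copy would halt, control
  passes to the entry of the second one.
\<close>

datatype bound = Lower | Upper

definition bank :: "bound \<Rightarrow> (bound \<times> 'c, 'v) memory \<Rightarrow> ('c, 'v) memory" where
  "bank b M = (\<lambda>c. M (b, c))"

fun goto :: "('l, 'c, 'v, 'a, 'b) algorithm \<Rightarrow> bound \<Rightarrow> 'l \<Rightarrow> bound \<times> 'l" where
  "goto A Lower l = (if program A l = None then (Upper, entry A) else (Lower, l))"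
| "goto A Upper l = (Upper, l)"

fun on_bank :: "('l, 'c, 'v, 'a, 'b) algorithm \<Rightarrow> bound \<Rightarrow> ('l, 'c, 'v) instr \<Rightarrow>
    (bound \<times> 'l, bound \<times> 'c, 'v) instr" where
  "on_bank A b (Write a e l) = Write (\<lambda>M. (b, a (bank b M))) (\<lambda>M. e (bank b M)) (goto A b l)"
| "on_bank A b (Branch p l l') = Branch (\<lambda>M. p (bank b M)) (goto A b l) (goto A b l')"

fun endpoint :: "bound \<Rightarrow> 'a \<times> 'a \<Rightarrow> 'a" where
  "endpoint Lower x = fst x"
| "endpoint Upper x = snd x"

definition interval_extension :: "('l, 'c, 'v, 'a, 'b) algorithm \<Rightarrow>
    (bound \<times> 'l, bound \<times> 'c, 'v, 'a \<times> 'a, 'b \<times> 'b) algorithm" where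
  "interval_extension A =
     \<lparr>entry = goto A Lower (entry A),
      program = (\<lambda>(b, l). map_option (on_bank A b) (program A l)),
      load = (\<lambda>x (b, c). load A (map (endpoint b) x) c),
      result = (\<lambda>M. zip (result A (bank Lower M)) (result A (bank Upper M)))\<rparr>"

text \<open>
  An interval counts as one datum: interval data have the size of the larger of their two
  tuples of bounds. In particular degenerate intervals \<open>[x, x]\<close> have the size of \<open>x\<close>, so that both
  complexities are functions of the same problem size.
\<close>

definition interval_size :: "('a list \<Rightarrow> nat) \<Rightarrow> ('a \<times> 'a) list \<Rightarrow> nat" where
  "interval_size sz x = max (sz (map fst x)) (sz (map snd x))"

definition ci_regular ::
  "('a list \<Rightarrow> nat) \<Rightarrow> 'a rel list \<Rightarrow> 'b rel list \<Rightarrow> ('l, 'c, 'v, 'a, 'b) algorithm \<Rightarrow> bool" where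
  "ci_regular sz Ss Ts A \<longleftrightarrow>
     interval_regular (product_order Ss) (product_order Ts) (induced_map A) \<and>
     same_complexity (product Ss) sz A
       (interval_product Ss) (interval_size sz) (interval_extension A)"


subsection \<open>The mapping induced by the interval extension\<close>

definition join :: "('c, 'v) memory \<Rightarrow> ('c, 'v) memory \<Rightarrow> (bound \<times> 'c, 'v) memory" where
  "join M N = (\<lambda>(b, c). case b of Lower \<Rightarrow> M c | Upper \<Rightarrow> N c)"

lemma bank_join [simp]: "bank Lower (join M N) = M" "bank Upper (join M N) = N"
  by (auto simp: bank_def join_def)

lemma join_upd [simp]:
  "(join M N)((Lower, a) := v) = join (M(a := v)) N"
  "(join M N)((Upper, a) := v) = join M (N(a := v))"
  by (auto simp: join_def fun_eq_iff split: bound.splits)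

lemma endpoint_eq [simp]: "endpoint Lower = fst" "endpoint Upper = snd"
  by (simp_all add: fun_eq_iff)

lemma config_0: "config A x 0 = (entry A, load A x)"
  and config_Suc: "config A x (Suc k) = step A (config A x k)"
  by (auto simp: config_def)

lemma halted_mono:
  assumes "halted A x k" "k \<le> m"
  shows "config A x m = config A x k"
  using assms(2)
proof (induction m rule: dec_induct)
  case (step m)
  then show ?case using assms(1) by (auto simp: config_Suc step_def halted_def)
qed simp

lemma not_halted_before: "k < time A x \<Longrightarrow> \<not> halted A x k"
  unfolding time_def by (rule not_less_Least)

lemma halted_time: "\<exists>k. halted A x k \<Longrightarrow> halted A x (time A x)"
  unfolding time_def by (rule LeastI_ex)

lemma config_lower:
  assumes "k \<le> time A (map fst x)"
  shows "config (interval_extension A) x k =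
    (goto A Lower (fst (config A (map fst x) k)),
     join (snd (config A (map fst x) k)) (load A (map snd x)))"
  using assms
proof (induction k)
  case 0
  show ?case
    by (auto simp: config_0 interval_extension_def join_def fun_eq_iff split: bound.splits)
next
  case (Suc k)
  obtain l M where c: "config A (map fst x) k = (l, M)" by fastforce
  have "program A l \<noteq> None" using Suc.prems not_halted_before[of k A "map fst x"] c by (simp add: halted_def)
  then obtain i where i: "program A l = Some i" by blast
  have "program (interval_extension A) (Lower, l) = Some (on_bank A Lower i)"
    by (simp add: interval_extension_def i)
  then show ?case using Suc c i
    by (cases i) (simp_all add: config_Suc step_def, simp add: fun_upd_def)
qed

lemma config_upper:
  assumes "\<exists>k. halted A (map fst x) k"
  shows "config (interval_extension A) x (time A (map fst x) + k) =
    ((Upper, fst (config A (map snd x) k)),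
     join (snd (config A (map fst x) (time A (map fst x)))) (snd (config A (map snd x) k)))"
proof (induction k)
  case 0
  then show ?case using halted_time[OF assms]
    by (auto simp: config_lower config_0 halted_def)
next
  case (Suc k)
  obtain l M where c: "config A (map snd x) k = (l, M)" by fastforce
  show ?case
  proof (cases "program A l")
    case None
    then show ?thesis using Suc c
      by (auto simp: config_Suc step_def interval_extension_def)
  next
    case (Some i)
    have "program (interval_extension A) (Upper, l) = Some (on_bank A Upper i)"
      by (simp add: interval_extension_def Some)
    then show ?thesis using Suc c Some
      by (cases i) (simp_all add: config_Suc step_def, simp add: fun_upd_def)
  qed
qed

lemma interval_extension_run:
  assumes lo: "\<exists>k. halted A (map fst x) k" and up: "\<exists>k. halted A (map snd x) k"
  shows halts_interval_extension: "\<exists>k. halted (interval_extension A) x k"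
    and time_interval_extension:
      "time (interval_extension A) x = time A (map fst x) + time A (map snd x)"
    and induced_map_interval_extension:
      "induced_map (interval_extension A) x =
         zip (induced_map A (map fst x)) (induced_map A (map snd x))"
proof -
  let ?I = "interval_extension A" and ?s = "time A (map fst x)" and ?t = "time A (map snd x)"
  have prog: "program ?I (b, l) = None \<longleftrightarrow> program A l = None" for b l
    by (simp add: interval_extension_def)
  have h: "halted ?I x (?s + k) \<longleftrightarrow> halted A (map snd x) k" for k
    by (simp add: halted_def config_upper[OF lo] prog)
  have n: "\<not> halted ?I x k" if "k < ?s" for k
    using that not_halted_before[OF that] by (simp add: halted_def config_lower prog del: not_None_eq)
  have H: "halted ?I x (?s + ?t)" using h halted_time[OF up] by blast
  then show "\<exists>k. halted ?I x k" by blast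
  show T: "time ?I x = ?s + ?t" unfolding time_def[of ?I]
  proof (rule Least_equality)
    show "halted ?I x (?s + ?t)" by (rule H)
  next
    fix k assume k: "halted ?I x k"
    then have "?s \<le> k" using n by (meson not_less)
    then obtain j where j: "k = ?s + j" using le_Suc_ex by blast
    then show "?s + ?t \<le> k" using k h not_halted_before[of j A "map snd x"] by (auto simp: not_less[symmetric])
  qed
  show "induced_map ?I x = zip (induced_map A (map fst x)) (induced_map A (map snd x))"
    by (simp add: induced_map_def T config_upper[OF lo]) (simp add: interval_extension_def)
qed

lemma listset_iff: "xs \<in> listset As \<longleftrightarrow> length xs = length As \<and> (\<forall>i<length As. xs ! i \<in> As ! i)"
proof (induction As arbitrary: xs)
  case (Cons A As)
  then show ?case by (cases xs) (auto simp: set_Cons_def All_less_Suc2)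
qed auto

lemma interval_product_iff:
  "x \<in> interval_product Ss \<longleftrightarrow> (map fst x, map snd x) \<in> product_order Ss"
  by (auto simp: interval_product_def product_order_def product_def listset_iff intervals_def
      case_prod_beta)

text \<open>
  The interval extension of a positive algorithm \<open>A\<close> is an algorithm that induces the mapping
  \<open>[l, u] \<mapsto> [f l, f u]\<close> from \<open>I(S\<^sub>1) \<times> \<dots> \<times> I(S\<^sub>n)\<close> to \<open>I(T\<^sub>1) \<times> \<dots> \<times> I(T\<^sub>m)\<close>, where \<open>f\<close> is the mapping
  induced by \<open>A\<close>.
\<close>

lemma algorithm_on_interval_extension:
  assumes A: "algorithm_on (product Ss) (product Ts) A" and pos: "positive Ss Ts A"
  shows "algorithm_on (interval_product Ss) (interval_product Ts) (interval_extension A)"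
  unfolding algorithm_on_def
proof (intro conjI ballI)
  have "dom (program (interval_extension A)) = UNIV \<times> dom (program A)"
    by (auto simp: interval_extension_def)
  moreover have "(UNIV :: bound set) = {Lower, Upper}" using bound.exhaust by auto
  then have "finite (UNIV :: bound set)" by (metis finite.emptyI finite.insertI)
  ultimately show "finite (dom (program (interval_extension A)))"
    using A by (simp add: algorithm_on_def)
next
  fix x assume x: "x \<in> interval_product Ss"
  let ?l = "map fst x" and ?u = "map snd x"
  have lu: "(?l, ?u) \<in> product_order Ss" and l: "?l \<in> product Ss" and u: "?u \<in> product Ss"
    using x by (auto simp: interval_product_iff product_order_def)
  have hl: "\<exists>k. halted A ?l k" and hu: "\<exists>k. halted A ?u k"
    and f: "finite (dom (load A ?l))" "finite (dom (load A ?u))"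
    using A l u by (auto simp: algorithm_on_def)
  show "\<exists>k. halted (interval_extension A) x k" by (rule halts_interval_extension[OF hl hu])
  have "dom (load (interval_extension A) x) \<subseteq>
      Pair Lower ` dom (load A ?l) \<union> Pair Upper ` dom (load A ?u)"
  proof
    fix bc assume "bc \<in> dom (load (interval_extension A) x)"
    moreover obtain b c where "bc = (b, c)" by fastforce
    ultimately show "bc \<in> Pair Lower ` dom (load A ?l) \<union> Pair Upper ` dom (load A ?u)"
      by (cases b) (auto simp: interval_extension_def)
  qed
  then show "finite (dom (load (interval_extension A) x))"
    using f by (meson finite_UnI finite_imageI finite_subset)
  have "(induced_map A ?l, induced_map A ?u) \<in> product_order Ts"
    using pos lu l u by (auto simp: positive_def monotone_on_def)
  moreover from this have "length (induced_map A ?l) = length (induced_map A ?u)"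
    by (auto simp: product_order_def product_def listset_iff)
  ultimately show "induced_map (interval_extension A) x \<in> interval_product Ts"
    by (simp add: induced_map_interval_extension[OF hl hu] interval_product_iff)
qed

end

theory Submission
  imports Defs
begin

text \<open>
  Let \<open>f\<close> be the map induced by a positive algorithm. By monotonicity, \<open>f\<close> sends the interval
  \<open>[l, u]\<close> into \<open>[f l, f u]\<close>, and it attains both bounds because, the orders being reflexive,
  \<open>l\<close> and \<open>u\<close> themselves lie in \<open>[l, u]\<close>; this is interval regularity
  (\<open>interval_regular_if_mono\<close>).

  For the complexities, the interval extension runs the algorithm once on \<open>l\<close> and once on \<open>u\<close>, in
  disjoint parts of the memory. Both its time and its space on \<open>[l, u]\<close> are therefore at most
  the sum of the costs on \<open>l\<close> and on \<open>u\<close> (for space, \<open>space_interval_extension_le\<close>). Since neither bound is larger than the interval, the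
  worst case at most doubles. Conversely, the run on the degenerate interval \<open>[x, x]\<close>, which has
  the size of \<open>x\<close>, contains a run on \<open>x\<close>, so the worst case does not decrease either. This
  transfer of pointwise cost bounds to worst cases is the same for time and space and is isolated in
  \<open>same_order_worst_case_interval\<close>.
\<close>

lemma product_order_refl:
  assumes "\<forall>r\<in>set Ss. Partial_order r" and "x \<in> product Ss"
  shows "(x, x) \<in> product_order Ss"
proof -
  have "(x ! i, x ! i) \<in> Ss ! i" if "i < length Ss" for i
  proof -
    have "Refl (Ss ! i)"
      using assms(1) that by (simp add: partial_order_on_def preorder_on_def)
    moreover have "x ! i \<in> Field (Ss ! i)"
      using assms(2) that by (simp add: product_def listset_iff)
    ultimately show ?thesis by (rule refl_onD)
  qed
  then show ?thesis using assms(2) by (simp add: product_order_def)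
qed

lemma interval_regular_if_mono:
  assumes refl: "Refl r"
    and mono: "\<And>x y. (x, y) \<in> r \<Longrightarrow> (f x, f y) \<in> s"
  shows "interval_regular r s f"
  unfolding interval_regular_def
proof
  fix x assume "x \<in> intervals r"
  then obtain l u where x: "x = (l, u)" and lu: "l \<in> Field r" "u \<in> Field r" "(l, u) \<in> r"
    by (auto simp: intervals_def)
  have bounds: "l \<in> interval_set r x" "u \<in> interval_set r x"
    using lu refl by (auto simp: x interval_set_def refl_on_def)
  have "(f l, f u) \<in> intervals s"
    using mono[OF lu(3)] by (auto simp: intervals_def intro: FieldI1 FieldI2)
  moreover have "f ` interval_set r x \<subseteq> interval_set s (f l, f u)"
    using mono by (auto simp: x interval_set_def intro: FieldI2)
  ultimately show "\<exists>y\<in>intervals s. f ` interval_set r x \<subseteq> interval_set s y \<and>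
      fst y \<in> f ` interval_set r x \<and> snd y \<in> f ` interval_set r x"
    using bounds by (intro bexI[of _ "(f l, f u)"]) auto
qed

lemma interval_regular_induced_map:
  assumes "\<forall>r\<in>set Ss. Partial_order r" and "positive Ss Ts A"
  shows "interval_regular (product_order Ss) (product_order Ts) (induced_map A)"
proof (rule interval_regular_if_mono)
  have "Field (product_order Ss) \<subseteq> product Ss"
    by (auto simp: Field_def product_order_def)
  then show "Refl (product_order Ss)"
    using product_order_refl[OF assms(1)] by (auto simp: refl_on_def)
  show "(induced_map A x, induced_map A y) \<in> product_order Ts" if "(x, y) \<in> product_order Ss" for x y
    using assms(2) that by (auto simp: positive_def monotone_on_def product_order_def)
qed

text \<open>
  Both bounds of an interval compete in the worst case for the same size, which gives the factor 2
  in one direction; in the other, the supremum is restricted to the degenerate intervals \<open>zip x x\<close>,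
  and the factor is 1.
\<close>

lemma same_order_worst_case_interval:
  assumes po: "\<forall>r\<in>set Ss. Partial_order r"
    and upper: "\<And>z. z \<in> interval_product Ss \<Longrightarrow> cost' z \<le> cost (map fst z) + cost (map snd z)"
    and lower: "\<And>x. x \<in> product Ss \<Longrightarrow> cost x \<le> cost' (zip x x)"
  shows "same_order (worst_case (product Ss) sz cost)
           (worst_case (interval_product Ss) (interval_size sz) cost')"
proof -
  let ?g = "worst_case (product Ss) sz cost"
  let ?h = "worst_case (interval_product Ss) (interval_size sz) cost'"
  have "?g N \<le> ?h N" for N
    unfolding worst_case_def
  proof (rule SUP_least)
    fix x assume x: "x \<in> {x \<in> product Ss. sz x \<le> N}"
    then have "zip x x \<in> interval_product Ss"
      using product_order_refl[OF po] by (simp add: interval_product_iff)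
    with x have "zip x x \<in> {z \<in> interval_product Ss. interval_size sz z \<le> N}"
      by (simp add: interval_size_def)
    moreover have "enat (cost x) \<le> enat (cost' (zip x x))" using x lower by simp
    ultimately show "enat (cost x) \<le>
        (SUP z\<in>{z \<in> interval_product Ss. interval_size sz z \<le> N}. enat (cost' z))"
      by (rule SUP_upper2)
  qed
  then have "bigo_enat ?g ?h"
    unfolding bigo_enat_def by (intro exI[of _ 1]) (simp add: one_enat_def[symmetric] del: One_nat_def)
  moreover have "?h N \<le> enat 2 * ?g N" for N
    unfolding worst_case_def[of "interval_product Ss"]
  proof (rule SUP_least)
    fix z assume z: "z \<in> {z \<in> interval_product Ss. interval_size sz z \<le> N}"
    then have "map fst z \<in> {x \<in> product Ss. sz x \<le> N}" "map snd z \<in> {x \<in> product Ss. sz x \<le> N}"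
      by (auto simp: interval_product_iff product_order_def interval_size_def)
    then have "enat (cost (map fst z)) \<le> ?g N" "enat (cost (map snd z)) \<le> ?g N"
      unfolding worst_case_def by (auto intro: SUP_upper)
    then have sum: "enat (cost (map fst z)) + enat (cost (map snd z)) \<le> ?g N + ?g N"
      by (rule add_mono)
    have "enat (cost' z) \<le> enat (cost (map fst z)) + enat (cost (map snd z))"
      using z upper by simp
    also note sum
    also have "?g N + ?g N = enat 2 * ?g N"
      by (simp add: mult_2 flip: numeral_eq_enat)
    finally show "enat (cost' z) \<le> enat 2 * ?g N" .
  qed
  then have "bigo_enat ?h ?g"
    unfolding bigo_enat_def by (intro exI[of _ 2]) simp
  ultimately show ?thesis by (simp add: same_order_def)
qed

lemma finite_dom_exec: "finite (dom M) \<Longrightarrow> finite (dom (snd (exec i M)))"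
  by (cases i) (auto simp del: fun_upd_apply)

lemma finite_dom_config:
  assumes "finite (dom (load A x))"
  shows "finite (dom (snd (config A x k)))"
proof (induction k)
  case 0
  then show ?case using assms by (simp add: config_0)
next
  case (Suc k)
  then show ?case by (auto simp: config_Suc step_def finite_dom_exec split: option.split)
qed

lemma card_dom_join:
  assumes "finite (dom M)" "finite (dom N)"
  shows "card (dom (join M N)) = card (dom M) + card (dom N)"
proof -
  have "dom (join M N) = Pair Lower ` dom M \<union> Pair Upper ` dom N"
    by (auto simp: dom_def join_def split: bound.splits)
  moreover have "Pair Lower ` dom M \<inter> Pair Upper ` dom N = {}" by auto
  ultimately show ?thesis
    using assms by (simp add: card_Un_disjoint card_image inj_on_def)
qed

lemma card_dom_config_le_space:
  "k \<le> time A x \<Longrightarrow> card (dom (snd (config A x k))) \<le> space A x"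
  unfolding space_def by (rule Max_ge) auto

lemma space_le_iff:
  "space A x \<le> n \<longleftrightarrow> (\<forall>k\<le>time A x. card (dom (snd (config A x k))) \<le> n)"
  unfolding space_def by (subst Max_le_iff) auto

text \<open>
  At each moment the two banks hold memories that occur in the runs on the two bounds: while the
  lower bank is active, the upper one is still in its initial state, and afterwards the lower one
  keeps its final state.
\<close>

lemma space_interval_extension_le:
  assumes lo: "\<exists>k. halted A (map fst z) k" and up: "\<exists>k. halted A (map snd z) k"
    and fin: "finite (dom (load A (map fst z)))" "finite (dom (load A (map snd z)))"
  shows "space (interval_extension A) z \<le> space A (map fst z) + space A (map snd z)"
  unfolding space_le_iff
proof (intro allI impI)
  let ?l = "map fst z" and ?u = "map snd z"
  fix k assume k: "k \<le> time (interval_extension A) z"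
  obtain i j where ij: "i \<le> time A ?l" "j \<le> time A ?u"
    and mem: "snd (config (interval_extension A) z k) =
      join (snd (config A ?l i)) (snd (config A ?u j))"
  proof (cases "k \<le> time A ?l")
    case True
    then show thesis using that[of k 0] by (simp add: config_lower config_0)
  next
    case False
    then obtain j where j: "k = time A ?l + j" by (metis le_Suc_ex nat_le_linear)
    then have "j \<le> time A ?u" using k by (simp add: time_interval_extension[OF lo up])
    then show thesis using that[of "time A ?l" j] by (simp add: j config_upper[OF lo])
  qed
  then show "card (dom (snd (config (interval_extension A) z k))) \<le> space A ?l + space A ?u"
    using ij by (simp add: card_dom_join finite_dom_config fin add_mono card_dom_config_le_space)
qed

lemma space_lower_le_space_interval_extension:
  assumes lo: "\<exists>k. halted A (map fst z) k" and up: "\<exists>k. halted A (map snd z) k"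
    and fin: "finite (dom (load A (map fst z)))" "finite (dom (load A (map snd z)))"
  shows "space A (map fst z) \<le> space (interval_extension A) z"
  unfolding space_le_iff[of A]
proof (intro allI impI)
  fix k assume k: "k \<le> time A (map fst z)"
  then have "card (dom (snd (config A (map fst z) k)))
      \<le> card (dom (snd (config (interval_extension A) z k)))"
    by (simp add: config_lower card_dom_join finite_dom_config fin)
  also have "\<dots> \<le> space (interval_extension A) z"
    using k by (intro card_dom_config_le_space) (simp add: time_interval_extension[OF lo up])
  finally show "card (dom (snd (config A (map fst z) k))) \<le> space (interval_extension A) z" .
qed

lemma same_complexity_interval_extension:
  assumes po: "\<forall>r\<in>set Ss. Partial_order r" and alg: "algorithm_on (product Ss) Y A"
  shows "same_complexity (product Ss) sz A
           (interval_product Ss) (interval_size sz) (interval_extension A)"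
proof -
  have halts: "\<exists>k. halted A x k" and fin: "finite (dom (load A x))" if "x \<in> product Ss" for x
    using alg that by (auto simp: algorithm_on_def)
  have bounds: "map fst z \<in> product Ss" "map snd z \<in> product Ss" if "z \<in> interval_product Ss" for z
    using that by (auto simp: interval_product_iff product_order_def)
  show ?thesis
    unfolding same_complexity_def
  proof (intro conjI; rule same_order_worst_case_interval[OF po])
    fix z assume z: "z \<in> interval_product Ss"
    note zs = halts[OF bounds(1)[OF z]] halts[OF bounds(2)[OF z]]
    show "time (interval_extension A) z \<le> time A (map fst z) + time A (map snd z)"
      by (simp add: time_interval_extension[OF zs])
    show "space (interval_extension A) z \<le> space A (map fst z) + space A (map snd z)"
      using zs fin bounds[OF z] by (intro space_interval_extension_le)
  next
    fix x assume x: "x \<in> product Ss"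
    show "time A x \<le> time (interval_extension A) (zip x x)"
      using time_interval_extension[of A "zip x x"] halts[OF x] by simp
    show "space A x \<le> space (interval_extension A) (zip x x)"
      using space_lower_le_space_interval_extension[of A "zip x x"] halts[OF x] fin[OF x] by simp
  qed
qed

theorem corollary9p13:
  fixes Ss :: "'a rel list" and Ts :: "'b rel list"
    and A :: "('l, 'c, 'v, 'a, 'b) algorithm"
    and sz :: "'a list \<Rightarrow> nat"
  assumes "\<forall>r\<in>set Ss. Partial_order r" and "\<forall>r\<in>set Ts. Partial_order r"
    and "algorithm_on (product Ss) (product Ts) A"
    and "positive Ss Ts A"
  shows "ci_regular sz Ss Ts A \<and>
    same_complexity (product Ss) sz A
      (interval_product Ss) (interval_size sz) (interval_extension A)"
  unfolding ci_regular_def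
  using interval_regular_induced_map[OF assms(1,4)]
    same_complexity_interval_extension[OF assms(1,3)] by blast

end
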